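(* Let $H$ be a smooth real-valued function on an open set $D\subseteq\mathbb{R}^{2m}$ with $f=J\nabla H$ analytic, where $J=\begin{pmatrix}0&I_m\\-I_m&0\end{pmatrix}$, and let $y_0\in D$, $r\ge1$ an integer, $h>0$. Let $\omega$ be a polynomial of degree at most $r$, with $\omega(t_0+ch)\in D$ for $c\in[0,1]$, solving $$\omega'(t_0+ch)=\sum_{j=0}^{r-1}\hat P_j(c)\int_0^1\hat P_j(\tau)\,J\nabla H(\omega(t_0+\tau h))\,\mathrm{d}\tau,\quad c\in[0,1],\qquad \omega(t_0)=y_0 .$$ Then $$H(\omega(t_0+h))=H(\omega(t_0))= H(y_0).$$
   Context: $\{\hat P_j\}_{j\ge 0}$ are the shifted Legendre polynomials on $[0,1]$, scaled to be orthonormal: $\deg \hat P_j=j$ and $\int_0^1 \hat P_i(x)\hat P_j(x)\,\mathrm{d}x=\delta_{ij}$ for all $i,j\ge 0$. The displayed problem is the truncated Fourier approximation of the canonical Hamiltonian problem $y'=J\nabla H(y)$, $y(t_0)=y_0$. *)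

theory Defs
  imports "HOL-Analysis.Analysis" "HOL-Computational_Algebra.Polynomial"
begin

text \<open>
  The space of dimension \<open>2m\<close> is \<open>real ^ ('m + 'm)\<close> with \<open>m = CARD('m)\<close>: the indices \<open>Inl i\<close> are
  the first \<open>m\<close> coordinates and the indices \<open>Inr i\<close> the last \<open>m\<close>.
\<close>

definition symplectic_J :: "real ^ ('m::finite + 'm) ^ ('m + 'm)" where
  "symplectic_J = (\<chi> i j. case (i, j) of
       (Inl a, Inr b) \<Rightarrow> mat 1 $ a $ b
     | (Inr a, Inl b) \<Rightarrow> - (mat 1 $ a $ b)
     | _ \<Rightarrow> 0)"

definition grad :: "('a::real_inner \<Rightarrow> real) \<Rightarrow> 'a \<Rightarrow> 'a" where
  "grad H x = (THE D. GDERIV H x :> D)"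

lemma grad_eq:
  assumes "GDERIV H x :> D"
  shows "grad H x = D"
  unfolding grad_def
proof (rule the_equality)
  fix E assume "GDERIV H x :> E"
  with assms have "(\<lambda>h. h \<bullet> D) = (\<lambda>h. h \<bullet> E)"
    unfolding gderiv_def by (rule has_derivative_unique)
  then have "(D - E) \<bullet> D = (D - E) \<bullet> E"
    by (rule fun_cong)
  then have "(D - E) \<bullet> (D - E) = 0"
    by (simp add: inner_diff_right)
  then show "E = D" by simp
qed (fact assms)

text \<open>The class \<open>C\<^sup>k\<close> is meant for open sets only, since derivatives are taken in the whole space.\<close>

primrec C_k_on :: "nat \<Rightarrow> ('a::real_normed_vector \<Rightarrow> 'b::real_normed_vector) \<Rightarrow> 'a set \<Rightarrow> bool" where
  "C_k_on 0 f S \<longleftrightarrow> continuous_on S f"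
| "C_k_on (Suc k) f S \<longleftrightarrow>
     (\<forall>x\<in>S. f differentiable (at x)) \<and>
     (\<forall>v. C_k_on k (\<lambda>x. frechet_derivative f (at x) v) S)"

definition smooth_on :: "('a::real_normed_vector \<Rightarrow> 'b::real_normed_vector) \<Rightarrow> 'a set \<Rightarrow> bool" where
  "smooth_on f S \<longleftrightarrow> (\<forall>k. C_k_on k f S)"

text \<open>
  Real analyticity in several variables: near every point of the set, \<open>f\<close> is the sum of a power
  series indexed by the multi-indices \<open>\<alpha> :: 'n \<Rightarrow> nat\<close>. Summability in the sense of \<open>has_sum\<close> is
  unconditional, which in finite dimension is the same as absolute convergence. The library's
  \<open>analytic_on\<close> covers functions of one complex variable only.
\<close>

definition real_analytic_on :: "(real ^ 'n::finite \<Rightarrow> real ^ 'k::finite) \<Rightarrow> (real ^ 'n) set \<Rightarrow> bool" where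
  "real_analytic_on f S \<longleftrightarrow>
     (\<forall>a\<in>S. \<exists>R>0. \<exists>c :: ('n \<Rightarrow> nat) \<Rightarrow> real ^ 'k. \<forall>x\<in>ball a R.
        ((\<lambda>\<alpha>. (\<Prod>i\<in>UNIV. (x $ i - a $ i) ^ \<alpha> i) *\<^sub>R c \<alpha>) has_sum f x) UNIV)"

text \<open>
  The degree and orthonormality conditions determine the scaled shifted Legendre polynomials up
  to the sign of each member of the family; no sign convention is imposed.
\<close>

definition orthonormal_shifted_legendre :: "(nat \<Rightarrow> real poly) \<Rightarrow> bool" where
  "orthonormal_shifted_legendre P \<longleftrightarrow>
     (\<forall>j. degree (P j) = j) \<and>
     (\<forall>i j. integral {0..1} (\<lambda>x. poly (P i) x * poly (P j) x) = (if i = j then 1 else 0))"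

definition poly_degree_le :: "nat \<Rightarrow> (real \<Rightarrow> 'a::real_vector) \<Rightarrow> bool" where
  "poly_degree_le r w \<longleftrightarrow> (\<exists>a. \<forall>t. w t = (\<Sum>k\<le>r. t ^ k *\<^sub>R a k))"

end

theory Submission
  imports Defs
begin

text \<open>
  Along the rescaled curve \<open>u c = \<omega> (t0 + c * h)\<close> write \<open>g c\<close> for the gradient of \<open>H\<close> at \<open>u c\<close>, and
  let \<open>v j\<close> be the Fourier coefficient of \<open>g\<close> against the \<open>j\<close>-th Legendre polynomial. Since \<open>J\<close> is
  constant, the coefficient of \<open>J g\<close> is \<open>J (v j)\<close>, so the velocity of \<open>u\<close> is
  \<open>h\<close> times the sum of the terms \<open>P j c * J (v j)\<close>. The chain rule gives
  \<open>(H \<circ> u)' c\<close> as \<open>h\<close> times the sum of the terms \<open>P j c * (J (v j) \<bullet> g c)\<close>, and integrating over the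
  unit interval turns each \<open>P j c * g c\<close> back into \<open>v j\<close>. The total change of \<open>H\<close> is therefore \<open>h\<close>
  times the sum of the terms \<open>J (v j) \<bullet> v j\<close>, all of which vanish because \<open>J\<close> is skew. Energy is
  conserved because the same weights are used to test the vector field and to reconstruct the
  velocity.

  This argument is \<open>skew_projected_gradient_flow_conserves\<close>. Smoothness of \<open>H\<close> enters through
  \<open>C1_has_gradient\<close> and \<open>C1_continuous_on_grad\<close>, which supply the chain rule and the integrability
  of the derivative.
\<close>

text \<open>The Riesz representation of the derivative, written out in the standard basis.\<close>

lemma differentiable_has_gradient:
  fixes H :: "'a::euclidean_space \<Rightarrow> real"
  assumes "H differentiable (at x)"
  shows "GDERIV H x :> (\<Sum>b\<in>Basis. frechet_derivative H (at x) b *\<^sub>R b)"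
proof -
  let ?F = "frechet_derivative H (at x)"
  have der: "(H has_derivative ?F) (at x)"
    using assms by (simp add: frechet_derivative_works)
  then have lin: "linear ?F"
    by (rule has_derivative_linear)
  have "?F v = v \<bullet> (\<Sum>b\<in>Basis. ?F b *\<^sub>R b)" for v
  proof -
    have "?F v = ?F (\<Sum>b\<in>Basis. (v \<bullet> b) *\<^sub>R b)"
      by (simp add: euclidean_representation)
    also have "\<dots> = (\<Sum>b\<in>Basis. (v \<bullet> b) * ?F b)"
      by (simp add: linear_sum[OF lin] linear_scale[OF lin])
    finally show ?thesis
      by (simp add: inner_sum_right mult.commute)
  qed
  then have "?F = (\<lambda>v. v \<bullet> (\<Sum>b\<in>Basis. ?F b *\<^sub>R b))"
    by (rule ext)
  with der show ?thesis
    unfolding gderiv_def by simp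
qed

lemma C1_has_gradient:
  fixes H :: "'a::euclidean_space \<Rightarrow> real"
  assumes "C_k_on (Suc 0) H S" and "x \<in> S"
  shows "GDERIV H x :> grad H x"
proof -
  have "H differentiable (at x)"
    using assms by simp
  from differentiable_has_gradient[OF this] show ?thesis
    by (simp add: grad_eq)
qed

lemma C1_continuous_on_grad:
  fixes H :: "'a::euclidean_space \<Rightarrow> real"
  assumes "C_k_on (Suc 0) H S"
  shows "continuous_on S (grad H)"
proof -
  have "continuous_on S (\<lambda>x. \<Sum>b\<in>Basis. frechet_derivative H (at x) b *\<^sub>R b)"
    using assms by (intro continuous_intros) auto
  moreover have "grad H x = (\<Sum>b\<in>Basis. frechet_derivative H (at x) b *\<^sub>R b)" if "x \<in> S" for x
    using assms that by (intro grad_eq differentiable_has_gradient) simp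
  ultimately show ?thesis
    by (simp cong: continuous_on_cong)
qed

lemma symplectic_J_skew: "transpose symplectic_J = - symplectic_J"
  by (simp add: vec_eq_iff transpose_def symplectic_J_def mat_def split: sum.split)

lemma inner_skew_matrix:
  fixes A :: "real ^ 'n::finite ^ 'n"
  assumes "transpose A = - A"
  shows "(A *v x) \<bullet> x = 0"
proof -
  have "(A *v x) \<bullet> x = x \<bullet> (transpose A *v x)"
    by (simp add: dot_lmul_matrix[symmetric] inner_commute)
  also have "\<dots> = - ((A *v x) \<bullet> x)"
    \<comment> \<open>The difference law at \<open>0 - A\<close> is the rule for \<open>(- A) *v x\<close>.\<close>
    using matrix_vector_mult_diff_rdistrib[of 0 A x] assms by (simp add: inner_commute)
  finally show ?thesis by simp
qed

text \<open>
  Integrating \<open>(H \<circ> u)'\<close> reproduces the moments \<open>integral {a..b} (\<lambda>\<tau>. \<phi> j \<tau> *\<^sub>R g \<tau>)\<close>, each of which is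
  paired with its own image under the skew map \<open>L\<close>, so the change of \<open>H\<close> cancels term by term.
\<close>

lemma skew_projected_gradient_flow_conserves:
  fixes H :: "'a::euclidean_space \<Rightarrow> real" and g u :: "real \<Rightarrow> 'a"
  assumes "a \<le> b"
    and L: "bounded_linear L" and skew: "\<And>v. L v \<bullet> v = 0"
    and cont_phi: "\<And>j. j \<in> S \<Longrightarrow> continuous_on {a..b} (\<phi> j)"
    and cont_g: "continuous_on {a..b} g"
    and grad: "\<And>c. c \<in> {a..b} \<Longrightarrow> GDERIV H (u c) :> g c"
    and flow: "\<And>c. c \<in> {a..b} \<Longrightarrow>
      (u has_vector_derivative
        s *\<^sub>R (\<Sum>j\<in>S. \<phi> j c *\<^sub>R integral {a..b} (\<lambda>\<tau>. \<phi> j \<tau> *\<^sub>R L (g \<tau>)))) (at c within {a..b})"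
  shows "H (u b) = H (u a)"
proof -
  define v where "v j = integral {a..b} (\<lambda>\<tau>. \<phi> j \<tau> *\<^sub>R g \<tau>)" for j
  have integrable: "(\<lambda>\<tau>. \<phi> j \<tau> *\<^sub>R g \<tau>) integrable_on {a..b}" if "j \<in> S" for j
    using cont_phi[OF that] cont_g by (intro integrable_continuous_real continuous_intros)
  have v: "((\<lambda>\<tau>. \<phi> j \<tau> *\<^sub>R g \<tau>) has_integral v j) {a..b}" if "j \<in> S" for j
    using integrable[OF that] by (simp add: v_def integrable_integral)
  have Lv: "integral {a..b} (\<lambda>\<tau>. \<phi> j \<tau> *\<^sub>R L (g \<tau>)) = L (v j)" if "j \<in> S" for j
    using integral_linear[OF integrable[OF that] L]
    by (simp add: o_def v_def linear_scale[OF bounded_linear.linear[OF L]])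

  let ?w = "\<lambda>c. s *\<^sub>R (\<Sum>j\<in>S. \<phi> j c *\<^sub>R L (v j))"
  have "(H \<circ> u has_vector_derivative ?w c \<bullet> g c) (at c within {a..b})" if c: "c \<in> {a..b}" for c
  proof -
    have "(u has_vector_derivative ?w c) (at c within {a..b})"
      using flow[OF c] by (simp add: Lv)
    moreover have "(H has_derivative (\<lambda>w. w \<bullet> g c)) (at (u c) within u ` {a..b})"
      using grad[OF c] unfolding gderiv_def by (rule has_derivative_at_withinI)
    ultimately show ?thesis
      by (rule vector_derivative_diff_chain_within)
  qed
  from fundamental_theorem_of_calculus[OF \<open>a \<le> b\<close> this]
  have change: "((\<lambda>c. ?w c \<bullet> g c) has_integral H (u b) - H (u a)) {a..b}"
    by simp

  have "((\<lambda>c. s * (\<Sum>j\<in>S. L (v j) \<bullet> (\<phi> j c *\<^sub>R g c))) has_integral s * (\<Sum>j\<in>S. L (v j) \<bullet> v j)) {a..b}"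
  proof (cases "finite S")
    case True
    then show ?thesis
      using has_integral_linear[OF v bounded_linear_inner_right]
      by (intro has_integral_mult_right has_integral_sum) (auto simp: o_def)
  qed simp
  then have "((\<lambda>c. ?w c \<bullet> g c) has_integral 0) {a..b}"
    by (simp add: skew inner_sum_left)
  from has_integral_unique[OF change this] show ?thesis
    by simp
qed

theorem theorem2p4:
  fixes H :: "real ^ ('m::finite + 'm) \<Rightarrow> real"
    and D :: "(real ^ ('m + 'm)) set"
    and y0 :: "real ^ ('m + 'm)"
    and r :: nat
    and h t0 :: real
    and P :: "nat \<Rightarrow> real poly"
    and \<omega> :: "real \<Rightarrow> real ^ ('m + 'm)"
  assumes "orthonormal_shifted_legendre P"
    and "open D"
    and "smooth_on H D"
    and "real_analytic_on (\<lambda>y. symplectic_J *v grad H y) D"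
    and "y0 \<in> D"
    and "r \<ge> 1"
    and "h > 0"
    and "poly_degree_le r \<omega>"
    and "\<And>c. c \<in> {0..1} \<Longrightarrow> \<omega> (t0 + c * h) \<in> D"
    and "\<And>c. c \<in> {0..1} \<Longrightarrow>
           (\<omega> has_vector_derivative
             (\<Sum>j<r. poly (P j) c *\<^sub>R
                integral {0..1} (\<lambda>\<tau>. poly (P j) \<tau> *\<^sub>R
                  (symplectic_J *v grad H (\<omega> (t0 + \<tau> * h))))))
           (at (t0 + c * h))"
    and "\<omega> t0 = y0"
  shows "H (\<omega> (t0 + h)) = H (\<omega> t0) \<and> H (\<omega> t0) = H y0"
proof -
  let ?J = "symplectic_J :: real ^ ('m + 'm) ^ ('m + 'm)"
  let ?u = "\<lambda>c. \<omega> (t0 + c * h)"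
  let ?g = "\<lambda>c. grad H (?u c)"
  let ?w = "\<lambda>c. \<Sum>j<r. poly (P j) c *\<^sub>R
    integral {0..1} (\<lambda>\<tau>. poly (P j) \<tau> *\<^sub>R (?J *v ?g \<tau>))"
  note in_D = assms(9) and flow = assms(10)
  have C1: "C_k_on (Suc 0) H D"
    using \<open>smooth_on H D\<close> unfolding smooth_on_def by blast

  have deriv: "(?u has_vector_derivative h *\<^sub>R ?w c) (at c within {0..1})" if "c \<in> {0..1}" for c
  proof -
    have "((\<lambda>c. t0 + c * h) has_vector_derivative h) (at c)"
      by (auto intro!: derivative_eq_intros simp: has_real_derivative_iff_has_vector_derivative[symmetric])
    from vector_diff_chain_at[OF this flow[OF that]] show ?thesis
      by (simp add: o_def has_vector_derivative_at_within)
  qed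
  have cont_u: "continuous_on {0..1} ?u"
    unfolding continuous_on_eq_continuous_within
    using has_vector_derivative_continuous[OF deriv] by blast
  have cont_g: "continuous_on {0..1} ?g"
    using in_D by (intro continuous_on_compose2[OF C1_continuous_on_grad[OF C1] cont_u]) auto

  have "H (?u 1) = H (?u 0)"
  proof (rule skew_projected_gradient_flow_conserves[where u = ?u and a = 0 and b = 1
        and L = "(*v) ?J" and g = ?g and s = h and \<phi> = "\<lambda>j. poly (P j)" and S = "{..<r}"])
    show "bounded_linear ((*v) ?J)"
      by (rule matrix_vector_mul_bounded_linear)
    show "(?J *v v) \<bullet> v = 0" for v
      by (rule inner_skew_matrix[OF symplectic_J_skew])
    show "GDERIV H (?u c) :> ?g c" if "c \<in> {0..1}" for c
      by (rule C1_has_gradient[OF C1 in_D[OF that]])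
    show "continuous_on {0..1} (poly (P j))" for j
      by (intro continuous_intros)
  qed (fact cont_g deriv zero_le_one)+
  then show ?thesis
    using \<open>\<omega> t0 = y0\<close> by simp
qed

end
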